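(* Let $q$ be a power of a prime $p$, let $\mathcal{T}$ be a multiset of points of $\mathrm{AG}(2,q)$, let $\lambda$ be an integer, and let $\mathcal{F}_\lambda$ be a set of $(q-\lambda)$-uniform directions w.r.t. $\mathcal{T}$. For each $(d)\in\mathcal{F}_\lambda$ denote the typical intersection number by $m_d$, and denote the intersection numbers with $\mathcal{T}$ of the renitent lines with slope $d$ by $t_{d,1},t_{d,2},\ldots,t_{d,\lambda_d}$, for some $0<\lambda_d\le\lambda$ (one entry for each renitent line with slope $d$). For $c\in\mathbb{F}_p\setminus\{0\}$ define the integers $\lambda_{d,i}(c)\in\{1,\ldots,p-1\}$ by $$c\,\lambda_{d,i}(c)\equiv t_{d,i}-m_d \pmod p,$$ and assume that (the sum being taken over natural numbers) $$\Lambda_d(c):=\sum_{i=1}^{\lambda_d}\lambda_{d,i}(c)\le \min\{q-2,p-1\}$$ holds for each $(d)\in\mathcal{F}_\lambda$. Then $\Lambda(c):=\Lambda_d(c)$ does not depend on $d$, and the renitent lines with direction in $\mathcal{F}_\lambda$ are contained in an algebraic envelope of class $\Lambda(c)$ such that: if $\ell$ is a renitent line with slope $d$, $(d)\in\mathcal{F}_\lambda$, and with intersection number $t_{d,i}$, then the intersection multiplicity of the pencil centered at $(d)$ with this envelope at $\ell$ is $\lambda_{d,i}(c)$.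
   Context: $\mathrm{AG}(2,q)$ is the desarguesian affine plane over $\mathbb{F}_q$, embedded in $\mathrm{PG}(2,q)$ as the set of points $(a:b:1)$; the line at infinity is $\ell_\infty=[0:0:1]$. Here $[u:v:w]$ denotes the line $\{(x:y:z): ux+vy+wz=0\}$. The points of $\ell_\infty$ are called directions: $(d)=(1:d:0)$ for $d\in\mathbb{F}_q$ and $(\infty)=(0:1:0)$. The affine lines with slope (direction) $d$ are the $q$ affine lines through $(d)$. Multisets are finite, and intersection sizes with $\mathcal{T}$ are counted with multiplicity. A direction $(d)$ is $(q-\lambda)$-uniform w.r.t. $\mathcal{T}$ if at least $q-\lambda$ affine lines with slope $d$ meet $\mathcal{T}$ in the same number of points modulo $p$; this number (modulo $p$) is the typical intersection number at $(d)$. If it is not uniquely determined, one such number is fixed for $(d)$. The other affine lines with slope $d$ (those whose intersection size with $\mathcal{T}$ is not congruent to the typical intersection number modulo $p$) are called renitent. An algebraic envelope of class $n$ is a curve of degree $n$ in the dual plane, i.e. it is given by a nonzero homogeneous polynomial $g\in\mathbb{F}_q[U,V,W]$ of degree $n$; a line $[u:v:w]$ is contained in it if $g(u,v,w)=0$. The pencil centered at a point $P=(x:y:z)$ is the set of lines through $P$; it is the line $xU+yV+zW=0$ of the dual plane. The intersection multiplicity of a pencil with an envelope at a line $\ell$ is the usual intersection multiplicity, in the dual plane, of this line $xU+yV+zW=0$ and the curve $g=0$ at the point of the dual plane corresponding to $\ell$, i.e. the multiplicity of that point as a zero of the restriction of $g$ to the line $xU+yV+zW=0$. *)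

theory Defs
  imports
    "HOL-Number_Theory.Number_Theory"
    "HOL-Computational_Algebra.Polynomial"
    "HOL-Library.Multiset"
    "HOL-Library.Poly_Mapping"
    "HOL-Library.Product_Plus"
    "HOL-Library.Extended_Nat"
    "HOL-Library.Cardinality"
begin

section \<open>The plane\<close>

text \<open>
  Points and lines of the projective plane are handled through homogeneous coordinates: a nonzero
  triple stands for the point \<open>(x : y : z)\<close>, respectively for the line \<open>[u : v : w]\<close>.
\<close>

type_synonym 'a triple = "'a \<times> 'a \<times> 'a"

fun incident :: "'a::comm_semiring_1 triple \<Rightarrow> 'a triple \<Rightarrow> bool" where
  "incident (x, y, z) (u, v, w) \<longleftrightarrow> u * x + v * y + w * z = 0"

text \<open>The points of the line at infinity \<open>[0 : 0 : 1]\<close>.\<close>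

datatype 'a direction = Slope 'a | Vertical

fun direction_point :: "'a::field direction \<Rightarrow> 'a triple" where
  "direction_point (Slope d) = (1, d, 0)"
| "direction_point Vertical = (0, 1, 0)"

text \<open>
  The affine point \<open>(a, b)\<close> is \<open>(a : b : 1)\<close>. An affine line, i.e. a line other than
  \<open>[0 : 0 : 1]\<close>, is identified with its set of affine points.
\<close>

definition affine_points :: "'a::field triple \<Rightarrow> ('a \<times> 'a) set" where
  "affine_points l = {(a, b). incident (a, b, 1) l}"

definition affine_line_coords :: "'a::field triple set" where
  "affine_line_coords = {(u, v, w). (u, v) \<noteq> (0, 0)}"

definition affine_lines :: "'a::field direction \<Rightarrow> ('a \<times> 'a) set set" where
  "affine_lines d =
     affine_points ` {l \<in> affine_line_coords. incident (direction_point d) l}"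


section \<open>Uniform directions and renitent lines\<close>

definition intersection_number :: "('a \<times> 'a) multiset \<Rightarrow> ('a \<times> 'a) set \<Rightarrow> nat" where
  "intersection_number T L = size {#P \<in># T. P \<in> L#}"

text \<open>
  Here \<open>m\<close> is any integer representing a residue class modulo \<open>p\<close>; the number \<open>q\<close> is
  \<open>CARD('a)\<close>. The difference \<open>q - \<lambda>\<close> is taken in the integers.
\<close>

definition typical_intersection_number ::
  "nat \<Rightarrow> ('a::{field,finite} \<times> 'a) multiset \<Rightarrow> int \<Rightarrow> 'a direction \<Rightarrow> int \<Rightarrow> bool" where
  "typical_intersection_number p T lam d m \<longleftrightarrow>
     int (card {L \<in> affine_lines d. [int (intersection_number T L) = m] (mod int p)})
       \<ge> int CARD('a) - lam"

definition uniform_direction ::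
  "nat \<Rightarrow> ('a::{field,finite} \<times> 'a) multiset \<Rightarrow> int \<Rightarrow> 'a direction \<Rightarrow> bool" where
  "uniform_direction p T lam d \<longleftrightarrow> (\<exists>m. typical_intersection_number p T lam d m)"

definition renitent_lines ::
  "nat \<Rightarrow> ('a::field \<times> 'a) multiset \<Rightarrow> 'a direction \<Rightarrow> int \<Rightarrow> ('a \<times> 'a) set set" where
  "renitent_lines p T d m =
     {L \<in> affine_lines d. \<not> [int (intersection_number T L) = m] (mod int p)}"

text \<open>The number \<open>\<lambda>\<^sub>d\<^sub>,\<^sub>i(c)\<close>, for \<open>t = t\<^sub>d\<^sub>,\<^sub>i\<close> and \<open>m = m\<^sub>d\<close>.\<close>

definition weight :: "nat \<Rightarrow> int \<Rightarrow> int \<Rightarrow> nat \<Rightarrow> nat" where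
  "weight p c m t = (THE k. k \<in> {1..p - 1} \<and> [c * int k = int t - m] (mod int p))"

lemma weight_ex1:
  assumes "prime p" and "\<not> int p dvd c" and "\<not> [int t = m] (mod int p)"
  shows "\<exists>!k. k \<in> {1..p - 1} \<and> [c * int k = int t - m] (mod int p)"
proof -
  have p: "p > 0" "prime (int p)" using assms(1) by (auto simp: prime_gt_0_nat)
  have cop: "coprime c (int p)"
    using p(2) assms(2) prime_imp_coprime coprime_commute by blast
  obtain y where y: "[c * y = int t - m] (mod int p)"
    using cong_solve_coprime_int[OF cop] by (metis cong_scalar_right mult.assoc mult.left_neutral mult.commute)
  define k where "k = nat (y mod int p)"
  have ik: "int k = y mod int p" using p(1) by (simp add: k_def)
  have 1: "[c * int k = int t - m] (mod int p)"
    using y unfolding ik cong_def by (simp add: mod_mult_right_eq)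
  have "k \<noteq> 0"
  proof
    assume "k = 0"
    hence "[int t - m = 0] (mod int p)" using 1 by (simp add: cong_sym_eq)
    thus False using assms(3) by (simp add: cong_diff_iff_cong_0)
  qed
  moreover have "k < p" using ik p(1) by (metis of_nat_0_less_iff of_nat_less_iff pos_mod_bound)
  ultimately have 2: "k \<in> {1..p - 1}" by auto
  show ?thesis
  proof (rule ex1I[of _ k])
    show "k \<in> {1..p - 1} \<and> [c * int k = int t - m] (mod int p)" using 1 2 by simp
  next
    fix j assume j: "j \<in> {1..p - 1} \<and> [c * int j = int t - m] (mod int p)"
    hence "[c * int j = c * int k] (mod int p)" using 1 cong_sym cong_trans by blast
    hence "[int j = int k] (mod int p)" using cop by (simp add: cong_mult_lcancel)
    hence "[j = k] (mod p)" by (simp add: cong_int_iff)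
    thus "j = k" using j \<open>k < p\<close> p(1) by (intro cong_less_modulus_unique_nat) auto
  qed
qed

definition total_weight ::
  "nat \<Rightarrow> ('a::field \<times> 'a) multiset \<Rightarrow> int \<Rightarrow> 'a direction \<Rightarrow> int \<Rightarrow> nat" where
  "total_weight p T c d m =
     (\<Sum>L\<in>renitent_lines p T d m. weight p c m (intersection_number T L))"


section \<open>Algebraic envelopes\<close>

text \<open>
  A polynomial in \<open>U, V, W\<close>: the coefficient of \<open>U^i V^j W^k\<close> is stored at \<open>(i, j, k)\<close>.
\<close>

type_synonym 'a poly3 = "nat triple \<Rightarrow>\<^sub>0 'a"

definition homogeneous3 :: "nat \<Rightarrow> 'a::zero poly3 \<Rightarrow> bool" where
  "homogeneous3 n g \<longleftrightarrow> (\<forall>(i, j, k) \<in> Poly_Mapping.keys g. i + j + k = n)"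

fun eval3 :: "'a::comm_semiring_1 poly3 \<Rightarrow> 'a triple \<Rightarrow> 'a" where
  "eval3 g (u, v, w) =
     (\<Sum>(i, j, k) \<in> Poly_Mapping.keys g. Poly_Mapping.lookup g (i, j, k) * u ^ i * v ^ j * w ^ k)"

definition envelope :: "nat \<Rightarrow> 'a::field poly3 \<Rightarrow> bool" where
  "envelope n g \<longleftrightarrow> g \<noteq> 0 \<and> homogeneous3 n g"

definition line_in_envelope :: "'a::field triple \<Rightarrow> 'a poly3 \<Rightarrow> bool" where
  "line_in_envelope l g \<longleftrightarrow> eval3 g l = 0"

text \<open>
  The restriction of \<open>g\<close> to the line of the dual plane through \<open>l\<close> and \<open>l'\<close>, in the affine
  coordinate \<open>X\<close> for which \<open>X = s\<close> is the point \<open>l + s l'\<close>; in particular \<open>l\<close> is \<open>X = 0\<close>.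
\<close>

fun restrict3 :: "'a::field poly3 \<Rightarrow> 'a triple \<Rightarrow> 'a triple \<Rightarrow> 'a poly" where
  "restrict3 g (u, v, w) (u', v', w') =
     eval3 (Poly_Mapping.map (\<lambda>a. [:a:]) g) ([:u, u':], [:v, v':], [:w, w':])"

fun scale3 :: "'a::times \<Rightarrow> 'a triple \<Rightarrow> 'a triple" where
  "scale3 a (u, v, w) = (a * u, a * v, a * w)"

definition other_pencil_lines :: "'a::field triple \<Rightarrow> 'a triple \<Rightarrow> 'a triple set" where
  "other_pencil_lines P l = {l'. incident P l' \<and> l' \<noteq> 0 \<and> (\<forall>a. l' \<noteq> scale3 a l)}"

text \<open>
  Intersection multiplicity at \<open>l\<close> of the pencil centered at \<open>P\<close> (where \<open>l\<close> is a line through \<open>P\<close>)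
  with the envelope \<open>g = 0\<close>; it is infinite if the whole pencil is contained in the envelope. The
  choice of \<open>l'\<close> does not matter, see \<open>pencil_multiplicity_eq\<close> below.
\<close>

definition pencil_multiplicity :: "'a::field triple \<Rightarrow> 'a poly3 \<Rightarrow> 'a triple \<Rightarrow> enat" where
  "pencil_multiplicity P g l =
     (let f = restrict3 g l (SOME l'. l' \<in> other_pencil_lines P l)
      in if f = 0 then \<infinity> else enat (order 0 f))"

definition binary_form :: "nat \<Rightarrow> ('a::field poly \<Rightarrow> 'a poly \<Rightarrow> 'a poly) \<Rightarrow> bool" where
  "binary_form n f \<longleftrightarrow> (\<exists>e. \<forall>A B. f A B = (\<Sum>j\<le>n. smult (e j) (A ^ (n - j) * B ^ j)))"

lemma binary_form_const: "binary_form 0 (\<lambda>A B. [:a:])"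
  unfolding binary_form_def by (intro exI[of _ "\<lambda>_. a"]) simp

lemma binary_form_sum:
  assumes "finite K" "\<And>k. k \<in> K \<Longrightarrow> binary_form n (f k)"
  shows "binary_form n (\<lambda>A B. \<Sum>k\<in>K. f k A B)"
proof -
  from assms(2) have "\<forall>k\<in>K. \<exists>e. \<forall>A B. f k A B = (\<Sum>j\<le>n. smult (e j) (A ^ (n - j) * B ^ j))"
    unfolding binary_form_def by blast
  then obtain e where e: "\<And>k A B. k \<in> K \<Longrightarrow>
      f k A B = (\<Sum>j\<le>n. smult (e k j) (A ^ (n - j) * B ^ j))"
    by metis
  have "(\<Sum>k\<in>K. f k A B) = (\<Sum>j\<le>n. smult (\<Sum>k\<in>K. e k j) (A ^ (n - j) * B ^ j))" for A B
  proof -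
    have "(\<Sum>k\<in>K. f k A B) = (\<Sum>k\<in>K. \<Sum>j\<le>n. smult (e k j) (A ^ (n - j) * B ^ j))"
      by (intro sum.cong refl e)
    also have "\<dots> = (\<Sum>j\<le>n. \<Sum>k\<in>K. smult (e k j) (A ^ (n - j) * B ^ j))"
      by (rule sum.swap)
    finally show ?thesis by (simp add: smult_sum)
  qed
  thus ?thesis unfolding binary_form_def by (intro exI[of _ "\<lambda>j. \<Sum>k\<in>K. e k j"]) simp
qed

lemma binary_form_mult_linear:
  assumes "binary_form n f"
  shows "binary_form (Suc n) (\<lambda>A B. f A B * (smult a A + smult b B))"
proof -
  obtain e where e: "\<And>A B. f A B = (\<Sum>j\<le>n. smult (e j) (A ^ (n - j) * B ^ j))"
    using assms unfolding binary_form_def by blast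
  define e1 where "e1 j = (if j \<le> n then a * e j else 0)" for j
  define e2 where "e2 j = (case j of 0 \<Rightarrow> 0 | Suc i \<Rightarrow> b * e i)" for j
  have "f A B * (smult a A + smult b B) =
      (\<Sum>j\<le>Suc n. smult (e1 j + e2 j) (A ^ (Suc n - j) * B ^ j))" for A B
  proof -
    have "(\<Sum>j\<le>Suc n. smult (e1 j) (A ^ (Suc n - j) * B ^ j)) =
        (\<Sum>j\<le>n. smult (e1 j) (A ^ (Suc n - j) * B ^ j))"
      by (simp add: e1_def)
    also have "\<dots> = f A B * smult a A"
      unfolding e sum_distrib_right
      by (intro sum.cong refl) (simp add: e1_def Suc_diff_le mult_ac)
    finally have 1: "(\<Sum>j\<le>Suc n. smult (e1 j) (A ^ (Suc n - j) * B ^ j)) = f A B * smult a A" .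
    have "(\<Sum>j\<le>Suc n. smult (e2 j) (A ^ (Suc n - j) * B ^ j)) =
        (\<Sum>j\<le>n. smult (e2 (Suc j)) (A ^ (n - j) * B ^ Suc j))"
      by (subst sum.atMost_Suc_shift) (simp add: e2_def)
    also have "\<dots> = f A B * smult b B"
      unfolding e sum_distrib_right
      by (intro sum.cong refl) (simp add: e2_def mult_ac)
    finally show ?thesis
      using 1 by (simp add: smult_add_left sum.distrib distrib_left)
  qed
  thus ?thesis unfolding binary_form_def by (intro exI[of _ "\<lambda>j. e1 j + e2 j"]) blast
qed

lemma binary_form_mult_linear_power:
  assumes "binary_form n f"
  shows "binary_form (n + i) (\<lambda>A B. f A B * (smult a A + smult b B) ^ i)"
proof (induction i)
  case 0
  show ?case using assms by simp
next
  case (Suc i)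
  from binary_form_mult_linear[OF this, of a b] show ?case by (simp add: mult_ac)
qed

lemma lookup_map_const: "Poly_Mapping.lookup (Poly_Mapping.map (\<lambda>a. [:a:]) g) k = [:Poly_Mapping.lookup g k:]"
  by (simp add: Poly_Mapping.map.rep_eq when_def)

lemma keys_map_const: "Poly_Mapping.keys (Poly_Mapping.map (\<lambda>a. [:a:]) g) = Poly_Mapping.keys g"
  by (auto simp: Poly_Mapping.in_keys_iff lookup_map_const)

lemma binary_form_eval3:
  assumes "homogeneous3 n g"
  shows "binary_form n (\<lambda>A B. eval3 (Poly_Mapping.map (\<lambda>a. [:a:]) g)
     (smult u A + smult u' B, smult v A + smult v' B, smult w A + smult w' B))"
proof -
  have *: "binary_form n (\<lambda>A B. [:Poly_Mapping.lookup g (i, j, k):] * (smult u A + smult u' B) ^ i *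
      (smult v A + smult v' B) ^ j * (smult w A + smult w' B) ^ k)"
    if "(i, j, k) \<in> Poly_Mapping.keys g" for i j k
  proof -
    have n: "n = 0 + i + j + k" using that assms by (auto simp: homogeneous3_def)
    show ?thesis
      unfolding n by (intro binary_form_mult_linear_power binary_form_const)
  qed
  show ?thesis
    unfolding eval3.simps keys_map_const lookup_map_const
    by (rule binary_form_sum) (use * in auto)
qed

lemma binary_form_restriction_dvd:
  fixes a b :: "'a::field"
  assumes "binary_form n f" and "[:0, 1:] ^ k dvd f 1 [:0, 1:]"
  shows "[:0, 1:] ^ k dvd f [:1, a:] [:0, b:]"
proof -
  obtain e where e: "\<And>A B. f A B = (\<Sum>j\<le>n. smult (e j) (A ^ (n - j) * B ^ j))"
    using assms(1) unfolding binary_form_def by blast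
  have "f 1 [:0, 1:] = (\<Sum>j\<le>n. monom (e j) j)"
    by (simp add: e monom_altdef)
  hence "coeff (f 1 [:0, 1:]) j = e j" if "j \<le> n" for j
    using that by (simp add: coeff_sum)
  moreover have "coeff (f 1 [:0, 1:]) j = 0" if "j < k" for j
    using assms(2) that by (metis monom_1_dvd_iff' monom_altdef smult_1_left)
  ultimately have z: "e j = 0" if "j \<le> n" "j < k" for j
    using that by metis
  have "[:0, 1:] ^ k dvd smult (e j) ([:1, a:] ^ (n - j) * [:0, b:] ^ j)" if "j \<le> n" for j
  proof (cases "j < k")
    case False
    have "[:0, b:] = smult b [:0, 1:]" by simp
    hence "[:0, b:] ^ j = smult (b ^ j) ([:0, 1:] ^ j)" by (simp only: smult_power)
    moreover have "[:0, 1:] ^ k dvd ([:0, 1:] :: 'a poly) ^ j"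
      using False by (intro le_imp_power_dvd) simp
    ultimately show ?thesis by (simp add: dvd_smult)
  qed (use z that in simp)
  thus ?thesis unfolding e by (intro dvd_sum) auto
qed

lemma other_pencil_lines_combination:
  assumes P: "P \<noteq> 0" and l: "l \<noteq> 0" "incident P l"
    and l1: "l1 \<in> other_pencil_lines P l" and l2: "l2 \<in> other_pencil_lines P l"
  shows "\<exists>a b. l2 = scale3 a l + scale3 b l1"
proof -
  obtain x y z where P': "P = (x, y, z)" by (cases P)
  obtain u v w where l': "l = (u, v, w)" by (cases l)
  obtain u1 v1 w1 where l1': "l1 = (u1, v1, w1)" by (cases l1)
  obtain u2 v2 w2 where l2': "l2 = (u2, v2, w2)" by (cases l2)
  have i: "u * x + v * y + w * z = 0" "u1 * x + v1 * y + w1 * z = 0" "u2 * x + v2 * y + w2 * z = 0"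
    using l l1 l2 unfolding other_pencil_lines_def P' l' l1' l2' by auto
  have nz: "x \<noteq> 0 \<or> y \<noteq> 0 \<or> z \<noteq> 0" "u \<noteq> 0 \<or> v \<noteq> 0 \<or> w \<noteq> 0"
    using P l unfolding P' l' by (auto simp: zero_prod_def)
  have ind: "\<And>a. \<not> (u1 = a * u \<and> v1 = a * v \<and> w1 = a * w)"
    using l1 unfolding other_pencil_lines_def l' l1' by auto
  define p1 p2 p3 where "p1 = u * v1 - v * u1" and "p2 = v * w1 - w * v1" and "p3 = w * u1 - u * w1"
  have det: "u2 * p2 + v2 * p3 + w2 * p1 = 0"
  proof -
    have "x * (u2 * p2 + v2 * p3 + w2 * p1) =
        (u * x + v * y + w * z) * (v1 * w2 - w1 * v2) + (u1 * x + v1 * y + w1 * z) * (w * v2 - v * w2) + (u2 * x + v2 * y + w2 * z) * (v * w1 - w * v1)"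
      unfolding p1_def p2_def p3_def by (simp add: algebra_simps)
    hence x0: "x * (u2 * p2 + v2 * p3 + w2 * p1) = 0" using i by simp
    have "y * (u2 * p2 + v2 * p3 + w2 * p1) =
        (u * x + v * y + w * z) * (w1 * u2 - u1 * w2) + (u1 * x + v1 * y + w1 * z) * (u * w2 - w * u2) + (u2 * x + v2 * y + w2 * z) * (w * u1 - u * w1)"
      unfolding p1_def p2_def p3_def by (simp add: algebra_simps)
    hence y0: "y * (u2 * p2 + v2 * p3 + w2 * p1) = 0" using i by simp
    have "z * (u2 * p2 + v2 * p3 + w2 * p1) =
        (u * x + v * y + w * z) * (u1 * v2 - v1 * u2) + (u1 * x + v1 * y + w1 * z) * (v * u2 - u * v2) + (u2 * x + v2 * y + w2 * z) * (u * v1 - v * u1)"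
      unfolding p1_def p2_def p3_def by (simp add: algebra_simps)
    hence z0: "z * (u2 * p2 + v2 * p3 + w2 * p1) = 0" using i by simp
    from x0 y0 z0 nz(1) show ?thesis by (metis mult_eq_0_iff)
  qed
  have "p1 \<noteq> 0 \<or> p2 \<noteq> 0 \<or> p3 \<noteq> 0"
  proof (rule ccontr)
    assume "\<not> ?thesis"
    hence "p1 = 0" "p2 = 0" "p3 = 0" by blast+
    hence p0: "u * v1 = v * u1" "v * w1 = w * v1" "w * u1 = u * w1"
      unfolding p1_def p2_def p3_def by (simp_all only: right_minus_eq)
    have q: "s = r / k * t" if "k \<noteq> 0" "k * s = t * r \<or> t * r = k * s" for k s t r :: 'a
      using that by (metis mult.commute nonzero_eq_divide_eq times_divide_eq_left)
    from nz(2) show False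
    proof (elim disjE)
      assume "u \<noteq> 0" thus False using ind[of "u1 / u"] q[of u v1 v u1] q[of u w1 w u1] p0 by (metis nonzero_eq_divide_eq mult.commute)
    next
      assume "v \<noteq> 0" thus False using ind[of "v1 / v"] q[of v u1 u v1] q[of v w1 w v1] p0 by (metis nonzero_eq_divide_eq mult.commute)
    next
      assume "w \<noteq> 0" thus False using ind[of "w1 / w"] q[of w u1 u w1] q[of w v1 v w1] p0 by (metis nonzero_eq_divide_eq mult.commute)
    qed
  qed
  moreover have q: "s = A / k * r + B / k * t" if "k * s = A * r + B * t" "k \<noteq> 0" for k s t r A B :: 'a
  proof -
    have "s = (A * r + B * t) / k" using that by (simp flip: that(1))
    thus ?thesis by (simp add: add_divide_distrib)
  qed
  ultimately have "\<exists>a b. u2 = a * u + b * u1 \<and> v2 = a * v + b * v1 \<and> w2 = a * w + b * w1"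
  proof (elim disjE)
    assume nz1: "p1 \<noteq> 0"
    have e0: "p1 * u2 = (u2 * v1 - v2 * u1) * u + (u * v2 - v * u2) * u1"
      unfolding p1_def p2_def p3_def by (simp add: algebra_simps)
    have e1: "p1 * v2 = (u2 * v1 - v2 * u1) * v + (u * v2 - v * u2) * v1"
      unfolding p1_def p2_def p3_def by (simp add: algebra_simps)
    have "p1 * w2 - ((u2 * v1 - v2 * u1) * w + (u * v2 - v * u2) * w1) = u2 * p2 + v2 * p3 + w2 * p1"
      unfolding p1_def p2_def p3_def by (simp add: algebra_simps)
    hence e2: "p1 * w2 = (u2 * v1 - v2 * u1) * w + (u * v2 - v * u2) * w1" using det by simp
    show ?thesis
      by (intro exI[of _ "(u2 * v1 - v2 * u1) / p1"] exI[of _ "(u * v2 - v * u2) / p1"], intro conjI)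
         (rule q[OF e0 nz1] q[OF e1 nz1] q[OF e2 nz1])+
  next
    assume nz1: "p2 \<noteq> 0"
    have "p2 * u2 - ((v2 * w1 - w2 * v1) * u + (v * w2 - w * v2) * u1) = u2 * p2 + v2 * p3 + w2 * p1"
      unfolding p1_def p2_def p3_def by (simp add: algebra_simps)
    hence e0: "p2 * u2 = (v2 * w1 - w2 * v1) * u + (v * w2 - w * v2) * u1" using det by simp
    have e1: "p2 * v2 = (v2 * w1 - w2 * v1) * v + (v * w2 - w * v2) * v1"
      unfolding p1_def p2_def p3_def by (simp add: algebra_simps)
    have e2: "p2 * w2 = (v2 * w1 - w2 * v1) * w + (v * w2 - w * v2) * w1"
      unfolding p1_def p2_def p3_def by (simp add: algebra_simps)
    show ?thesis
      by (intro exI[of _ "(v2 * w1 - w2 * v1) / p2"] exI[of _ "(v * w2 - w * v2) / p2"], intro conjI)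
         (rule q[OF e0 nz1] q[OF e1 nz1] q[OF e2 nz1])+
  next
    assume nz1: "p3 \<noteq> 0"
    have e0: "p3 * u2 = (w2 * u1 - u2 * w1) * u + (w * u2 - u * w2) * u1"
      unfolding p1_def p2_def p3_def by (simp add: algebra_simps)
    have "p3 * v2 - ((w2 * u1 - u2 * w1) * v + (w * u2 - u * w2) * v1) = u2 * p2 + v2 * p3 + w2 * p1"
      unfolding p1_def p2_def p3_def by (simp add: algebra_simps)
    hence e1: "p3 * v2 = (w2 * u1 - u2 * w1) * v + (w * u2 - u * w2) * v1" using det by simp
    have e2: "p3 * w2 = (w2 * u1 - u2 * w1) * w + (w * u2 - u * w2) * w1"
      unfolding p1_def p2_def p3_def by (simp add: algebra_simps)
    show ?thesis
      by (intro exI[of _ "(w2 * u1 - u2 * w1) / p3"] exI[of _ "(w * u2 - u * w2) / p3"], intro conjI)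
         (rule q[OF e0 nz1] q[OF e1 nz1] q[OF e2 nz1])+
  qed
  thus ?thesis unfolding l' l1' l2' by auto
qed

lemma restrict3_dvd:
  assumes "P \<noteq> 0" "l \<noteq> 0" "incident P l" "homogeneous3 n g"
    and "l1 \<in> other_pencil_lines P l" "l2 \<in> other_pencil_lines P l"
    and dvd: "[:0, 1:] ^ k dvd restrict3 g l l1"
  shows "[:0, 1:] ^ k dvd restrict3 g l l2"
proof -
  obtain a b where ab: "l2 = scale3 a l + scale3 b l1"
    using other_pencil_lines_combination assms by blast
  obtain u v w where l': "l = (u, v, w)" by (cases l)
  obtain u1 v1 w1 where l1': "l1 = (u1, v1, w1)" by (cases l1)
  let ?f = "\<lambda>A B. eval3 (Poly_Mapping.map (\<lambda>a. [:a:]) g)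
     (smult u A + smult u1 B, smult v A + smult v1 B, smult w A + smult w1 B)"
  have "restrict3 g l l1 = ?f 1 [:0, 1:]"
    unfolding l' l1' restrict3.simps by (simp add: one_pCons)
  moreover have "restrict3 g l l2 = ?f [:1, a:] [:0, b:]"
    unfolding ab l' l1' by (simp add: mult.commute)
  ultimately show ?thesis
    using binary_form_restriction_dvd[OF binary_form_eval3[OF assms(4)]] dvd by metis
qed

lemma other_pencil_lines_nonempty:
  assumes "P \<noteq> 0" "l \<noteq> 0"
  shows "\<exists>l'. l' \<in> other_pencil_lines P l"
proof -
  obtain x y z where P': "P = (x, y, z)" by (cases P)
  obtain u v w where l': "l = (u, v, w)" by (cases l)
  have nz: "x \<noteq> 0 \<or> y \<noteq> 0 \<or> z \<noteq> 0" using assms(1) unfolding P' by (auto simp: zero_prod_def)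
  let ?c = "{(y, - x, 0), (0, z, - y), (z, 0, - x)}"
  have "\<exists>l'\<in>?c. l' \<in> other_pencil_lines P l"
  proof (rule ccontr)
    assume "\<not> ?thesis"
    hence "\<And>c. c \<in> ?c \<Longrightarrow> c = 0 \<or> (\<exists>a. c = scale3 a l)"
      unfolding other_pencil_lines_def P' by (auto simp: mult.commute)
    hence "\<And>c. c \<in> ?c \<Longrightarrow> \<exists>a. c = scale3 a l"
      unfolding l' by (metis mult_zero_left scale3.simps zero_prod_def)
    then obtain a1 a2 a3 where a: "(y, - x, 0) = scale3 a1 l" "(0, z, - y) = scale3 a2 l"
        "(z, 0, - x) = scale3 a3 l"
      by (meson insertCI)
    have e: "a1 * u = y" "a1 * v = - x" "a1 * w = 0" "a2 * u = 0" "a2 * v = z" "a2 * w = - y"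
        "a3 * u = z" "a3 * v = 0" "a3 * w = - x"
      using a unfolding l' by auto
    from nz show False
    proof -
      have "z = 0"
      proof (rule ccontr)
        assume "z \<noteq> 0"
        hence "u \<noteq> 0" "a2 \<noteq> 0" using e by auto
        thus False using e(4) by simp
      qed
      moreover from this nz have "a1 \<noteq> 0" using e(1,2) by auto
      hence "w = 0" using e(3) by simp
      hence "x = 0" "y = 0" using e(6,9) by auto
      ultimately show ?thesis using nz by simp
    qed
  qed
  thus ?thesis by blast
qed

lemma pencil_multiplicity_eq:
  assumes "P \<noteq> 0" "l \<noteq> 0" "incident P l" "homogeneous3 n g" "l' \<in> other_pencil_lines P l"
  shows "pencil_multiplicity P g l =
    (if restrict3 g l l' = 0 then \<infinity> else enat (order 0 (restrict3 g l l')))"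
proof -
  define l0 where "l0 = (SOME l'. l' \<in> other_pencil_lines P l)"
  have l0: "l0 \<in> other_pencil_lines P l" unfolding l0_def using assms(5) by (rule someI)
  have "[:0, 1:] ^ k dvd restrict3 g l l0 \<longleftrightarrow> [:0, 1:] ^ k dvd restrict3 g l l'" for k
    using restrict3_dvd[OF assms(1-4)] l0 assms(5) by blast
  moreover have "(if f = 0 then \<infinity> else enat (order 0 f)) = (if h = 0 then \<infinity> else enat (order 0 h))"
    if eq: "\<And>k. [:0, 1:] ^ k dvd f \<longleftrightarrow> [:0, 1:] ^ k dvd h" for f h :: "'a poly"
  proof -
    have "f = 0 \<or> k \<le> order 0 f \<longleftrightarrow> h = 0 \<or> k \<le> order 0 h" for k
      using eq[of k] order_divides[of 0 k f] order_divides[of 0 k h] by simp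
    thus ?thesis by (metis order.eq_iff not_less_eq_eq)
  qed
  ultimately show ?thesis
    unfolding pencil_multiplicity_def l0_def[symmetric] Let_def by blast
qed

end

theory Submission
  imports Defs "HOL-Computational_Algebra.Polynomial_FPS"
begin

text \<open>
  Fix \<open>(u, v)\<close> and let \<open>[u : v : w]\<close> run through the corresponding parallel class; the point
  \<open>(a, b)\<close> lies on the line with \<open>w = - (u a + v b)\<close>. As \<open>\<Sum>\<^sub>w w\<^sup>j = 0\<close> for \<open>j \<le> q - 2\<close>, the typical
  intersection number drops out of \<open>\<Sum>\<^sub>w |T \<inter> [u : v : w]| w\<^sup>j\<close>, so the \<open>j\<close>-th power sum of the
  multiset of the renitent \<open>w\<close>, each taken with its weight, is
  \<open>c\<^sup>-\<^sup>1 \<Sum>\<^sub>(\<^sub>a\<^sub>,\<^sub>b\<^sub>)\<^sub>\<in>\<^sub>T (- (u a + v b))\<^sup>j\<close>: a binary form of degree \<open>j\<close> in \<open>(u, v)\<close> that does not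
  depend on the direction. The case \<open>j = 0\<close> determines the total weight \<open>n < p\<close>. Since
  \<open>1, \<dots>, n\<close> are invertible modulo \<open>p\<close>, Newton's identities turn the power sums into binary forms
  \<open>a\<^sub>k(u, v)\<close> of degree \<open>k\<close>, the signed elementary symmetric polynomials of the multiset, and
  \<open>g = \<Sum>\<^sub>k a\<^sub>k(U, V) W\<^sup>n\<^sup>-\<^sup>k\<close> restricts to \<open>\<Prod>\<^sub>w (W - w)\<^bsup>\<mu>(w)\<^esup>\<close> on the pencil, where \<open>\<mu>(w)\<close> is
  the weight of \<open>[u : v : w]\<close>.
\<close>

section \<open>Power sums over a finite field\<close>

lemma power_sum_UNIV_eq_0:
  assumes "j \<le> CARD('a) - 2"
  shows "(\<Sum>x\<in>(UNIV :: 'a::{field,finite} set). x ^ j) = 0"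
proof (cases "j = 0")
  case True
  have "CHAR('a) dvd CARD('a)" by (rule CHAR_dvd_CARD)
  thus ?thesis using True by (simp add: of_nat_eq_0_iff_char_dvd)
next
  case False
  \<comment> \<open>This polynomial has at most \<open>j\<close>, hence fewer than
    \<open>q - 1\<close>, roots, so some nonzero \<open>y\<close> has
    \<open>y ^ j \<noteq> 1\<close>. Multiplication by \<open>y\<close> permutes the field, so it
    preserves the power sum while scaling it by \<open>y ^ j\<close>.\<close>
  let ?f = "monom 1 j - 1 :: 'a poly"
  have "coeff ?f j = 1" using False by simp
  hence nz: "?f \<noteq> 0" by (metis coeff_0 zero_neq_one)
  have "degree ?f \<le> j" by (intro degree_diff_le) (auto simp: degree_monom_le)
  hence "card {x. poly ?f x = 0} \<le> j" using card_poly_roots_bound[OF nz] by linarith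
  moreover have "card (UNIV - {0 :: 'a}) = CARD('a) - 1" by (simp add: card_Diff_singleton)
  moreover have "CARD('a) \<ge> 2"
    using card_mono[of "UNIV :: 'a set" "{0, 1}"] by simp
  ultimately have "\<not> UNIV - {0} \<subseteq> {x. poly ?f x = 0}"
    using assms card_mono[of "{x. poly ?f x = 0}" "UNIV - {0 :: 'a}"] by force
  then obtain y :: 'a where y: "y \<noteq> 0" "y ^ j \<noteq> 1" by (auto simp: poly_monom)
  have "bij (\<lambda>x. y * x)"
    by (rule bij_betw_byWitness[where f' = "\<lambda>x. x / y"]) (use y in auto)
  hence "(\<Sum>x\<in>UNIV. x ^ j) = (\<Sum>x\<in>UNIV. (y * x) ^ j)"
    using sum.reindex_bij_betw[of "\<lambda>x. y * x" UNIV UNIV "\<lambda>x. x ^ j"] by simp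
  also have "\<dots> = y ^ j * (\<Sum>x\<in>UNIV. x ^ j)" by (simp add: power_mult_distrib sum_distrib_left)
  finally have "(1 - y ^ j) * (\<Sum>x\<in>UNIV. x ^ j) = 0" by (simp add: algebra_simps)
  thus ?thesis using y by simp
qed

section \<open>Newton's identities\<close>

text \<open>\<open>- P\<close> plays the role of \<open>X\<close> times the logarithmic derivative
  of \<open>f\<close>, and logarithmic derivatives add up under multiplication.\<close>

lemma log_deriv_mult:
  fixes f g P Q :: "'a::comm_ring_1 fps"
  assumes "fps_X * fps_deriv f = - f * P" "fps_X * fps_deriv g = - g * Q"
  shows "fps_X * fps_deriv (f * g) = - (f * g) * (P + Q)"
proof -
  have "fps_X * fps_deriv (f * g) = f * (fps_X * fps_deriv g) + (fps_X * fps_deriv f) * g"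
    by (simp add: algebra_simps)
  thus ?thesis unfolding assms by (simp add: algebra_simps)
qed

text \<open>Geometric series: \<open>- w X / (1 - w X)\<close> is minus the sum of
  \<open>w ^ j X ^ j\<close> over \<open>j > 0\<close>, hence the vanishing constant term.\<close>

lemma log_deriv_linear:
  fixes w :: "'a::field"
  shows "fps_X * fps_deriv (fps_of_poly [:1, - w:]) =
    - fps_of_poly [:1, - w:] * Abs_fps (\<lambda>j. if j = 0 then 0 else w ^ j)"
proof (rule fps_ext)
  fix n
  show "fps_nth (fps_X * fps_deriv (fps_of_poly [:1, - w:])) n =
    fps_nth (- fps_of_poly [:1, - w:] * Abs_fps (\<lambda>j. if j = 0 then 0 else w ^ j)) n"
    by (cases n; cases "n - 1") (auto simp: fps_of_poly_linear' ring_distribs mult.assoc coeff_pCons fps_X_mult_nth)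
qed

lemma log_deriv_linear_power:
  fixes w :: "'a::field"
  shows "fps_X * fps_deriv (fps_of_poly ([:1, - w:] ^ k)) =
    - fps_of_poly ([:1, - w:] ^ k) * Abs_fps (\<lambda>j. if j = 0 then 0 else of_nat k * w ^ j)"
proof (induction k)
  case 0
  have "Abs_fps (\<lambda>j. if j = 0 then 0 else of_nat 0 * w ^ j) = 0" by (rule fps_ext) simp
  thus ?case by simp
next
  case (Suc k)
  have "Abs_fps (\<lambda>j. if j = 0 then 0 else w ^ j) + Abs_fps (\<lambda>j. if j = 0 then 0 else of_nat k * w ^ j)
      = Abs_fps (\<lambda>j. if j = 0 then 0 else of_nat (Suc k) * w ^ j)"
    by (rule fps_ext) (simp add: algebra_simps)
  with log_deriv_mult[OF log_deriv_linear[of w] Suc] show ?case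
    by (simp only: power_Suc fps_of_poly_mult)
qed

lemma log_deriv_prod_linear_power:
  fixes \<mu> :: "'a::field \<Rightarrow> nat"
  assumes "finite S"
  shows "fps_X * fps_deriv (fps_of_poly (\<Prod>w\<in>S. [:1, - w:] ^ \<mu> w)) =
    - fps_of_poly (\<Prod>w\<in>S. [:1, - w:] ^ \<mu> w) *
      Abs_fps (\<lambda>j. if j = 0 then 0 else \<Sum>w\<in>S. of_nat (\<mu> w) * w ^ j)"
  using assms
proof (induction S rule: finite_induct)
  case empty
  have "Abs_fps (\<lambda>j. if j = 0 then 0 else \<Sum>w\<in>{}. of_nat (\<mu> w) * w ^ j) = 0"
    by (rule fps_ext) simp
  thus ?case by simp
next
  case (insert x S)
  have "Abs_fps (\<lambda>j. if j = 0 then 0 else of_nat (\<mu> x) * x ^ j) +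
      Abs_fps (\<lambda>j. if j = 0 then 0 else \<Sum>w\<in>S. of_nat (\<mu> w) * w ^ j) =
      Abs_fps (\<lambda>j. if j = 0 then 0 else \<Sum>w\<in>insert x S. of_nat (\<mu> w) * w ^ j)"
    using insert(1,2) by (intro fps_ext) simp
  with log_deriv_mult[OF log_deriv_linear_power[of x "\<mu> x"] insert(3)] insert(1,2) show ?case
    by (simp only: prod.insert[OF insert(1,2)] fps_of_poly_mult)
qed

lemma degree_prod_linear_power:
  fixes \<mu> :: "'a::field \<Rightarrow> nat"
  assumes "finite S"
  shows "degree (\<Prod>w\<in>S. [:- w, 1:] ^ \<mu> w) = (\<Sum>w\<in>S. \<mu> w)"
  using assms by (subst degree_prod_eq_sum_degree) (auto simp: degree_linear_power)

text \<open>Compares the coefficients at \<open>Suc k\<close> in the logarithmic derivative formula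
  for the product of the \<open>(1 - w X) ^ \<mu> w\<close>, which is \<open>f\<close> with its
  coefficients reversed.\<close>

lemma newton_identity:
  fixes \<mu> :: "'a::field \<Rightarrow> nat"
  assumes "finite S" and k: "Suc k \<le> (\<Sum>w\<in>S. \<mu> w)"
  defines "f \<equiv> \<Prod>w\<in>S. [:- w, 1:] ^ \<mu> w" and "n \<equiv> \<Sum>w\<in>S. \<mu> w"
  shows "of_nat (Suc k) * coeff f (n - Suc k) =
    - (\<Sum>i\<le>k. coeff f (n - i) * (\<Sum>w\<in>S. of_nat (\<mu> w) * w ^ (Suc k - i)))"
proof -
  let ?g = "\<Prod>w\<in>S. [:1, - w:] ^ \<mu> w"
  let ?P = "Abs_fps (\<lambda>j. if j = 0 then 0 else \<Sum>w\<in>S. of_nat (\<mu> w) * w ^ j)"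
  \<comment> \<open>For \<open>w = 0\<close> the degree drops: both sides are the constant
    1.\<close>
  have "reflect_poly [:- w, 1:] = [:1, - w:]" for w :: 'a
    by (cases "w = 0") (auto simp: reflect_poly_def)
  hence g: "?g = reflect_poly f"
    by (simp add: f_def reflect_poly_prod reflect_poly_power)
  have "degree f = n" unfolding f_def n_def by (rule degree_prod_linear_power[OF assms(1)])
  hence c: "coeff ?g i = coeff f (n - i)" if "i \<le> n" for i
    using that by (simp add: g coeff_reflect_poly)
  have "of_nat (Suc k) * coeff ?g (Suc k) = fps_nth (fps_X * fps_deriv (fps_of_poly ?g)) (Suc k)"
    by simp
  also have "\<dots> = fps_nth (- fps_of_poly ?g * ?P) (Suc k)"
    unfolding log_deriv_prod_linear_power[OF assms(1)] ..
  also have "\<dots> = - (\<Sum>i=0..Suc k. coeff ?g i * fps_nth ?P (Suc k - i))"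
    by (simp add: fps_mult_nth sum_negf)
  \<comment> \<open>The summand \<open>i = Suc k\<close> disappears since \<open>?P\<close> has
    constant term 0.\<close>
  also have "(\<Sum>i=0..Suc k. coeff ?g i * fps_nth ?P (Suc k - i)) =
      (\<Sum>i\<le>k. coeff f (n - i) * (\<Sum>w\<in>S. of_nat (\<mu> w) * w ^ (Suc k - i)))"
    using k unfolding atLeast0AtMost sum.atMost_Suc n_def[symmetric]
    by (auto intro!: sum.cong simp: c)
  finally show ?thesis using c[of "Suc k"] k by (simp add: n_def)
qed

text \<open>
  The \<open>k\<close>-th elementary symmetric polynomial, up to the sign \<open>(-1)\<^sup>k\<close>, computed from the power
  sums \<open>s\<close>; the division is junk as soon as \<open>k\<close> reaches the characteristic.
\<close>

fun newton :: "(nat \<Rightarrow> 'a::field poly) \<Rightarrow> nat \<Rightarrow> 'a poly" where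
  "newton s 0 = 1"
| "newton s (Suc k) = smult (- inverse (of_nat (Suc k))) (\<Sum>i\<le>k. newton s i * s (Suc k - i))"

text \<open>The recursion is Newton's identity solved for the next coefficient, which requires
  \<open>k\<close> to be invertible in the field. Scalars appear as constant polynomials because
  \<open>newton\<close> is also applied to forms.\<close>

lemma newton_eq_coeff:
  fixes \<mu> :: "'a::field \<Rightarrow> nat"
  assumes "finite S"
  defines "f \<equiv> \<Prod>w\<in>S. [:- w, 1:] ^ \<mu> w" and "n \<equiv> \<Sum>w\<in>S. \<mu> w"
  assumes s: "\<And>j. 0 < j \<Longrightarrow> j \<le> n \<Longrightarrow> s j = [:\<Sum>w\<in>S. of_nat (\<mu> w) * w ^ j:]"
    and inv: "\<And>k. 0 < k \<Longrightarrow> k \<le> n \<Longrightarrow> of_nat k \<noteq> (0 :: 'a)"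
  shows "k \<le> n \<Longrightarrow> newton s k = [:coeff f (n - k):]"
proof (induction k rule: less_induct)
  case (less k)
  show ?case
  proof (cases k)
    case 0
    have "degree f = n" unfolding f_def n_def by (rule degree_prod_linear_power[OF assms(1)])
    moreover have "lead_coeff f = 1"
      unfolding f_def by (simp add: lead_coeff_prod lead_coeff_power)
    ultimately show ?thesis using 0 by (simp add: one_pCons)
  next
    case (Suc k')
    have "(\<Sum>i\<le>k'. newton s i * s (Suc k' - i)) =
        (\<Sum>i\<le>k'. [:coeff f (n - i) * (\<Sum>w\<in>S. of_nat (\<mu> w) * w ^ (Suc k' - i)):])"
      using less Suc s by (intro sum.cong refl) auto
    also have "\<dots> = [:- (of_nat k * coeff f (n - k)):]"
      using newton_identity[OF assms(1), of k' \<mu>] less Suc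
      by (simp add: f_def n_def flip: sum_to_poly)
    finally show ?thesis using inv[of k] less Suc by (simp add: field_simps del: of_nat_Suc)
  qed
qed

section \<open>Binary and ternary forms\<close>

lemma binary_form_smult:
  assumes "binary_form n f"
  shows "binary_form n (\<lambda>A B. smult a (f A B))"
proof -
  obtain e where e: "\<And>A B. f A B = (\<Sum>j\<le>n. smult (e j) (A ^ (n - j) * B ^ j))"
    using assms unfolding binary_form_def by blast
  show ?thesis unfolding binary_form_def
    by (rule exI[of _ "\<lambda>j. a * e j"]) (simp add: e sum_distrib_left[of "[:a:]", simplified])
qed

lemma binary_form_mult:
  assumes f: "binary_form n f" and g: "binary_form k g"
  shows "binary_form (n + k) (\<lambda>A B. f A B * g A B)"
proof -
  obtain e where e: "\<And>A B. g A B = (\<Sum>j\<le>k. smult (e j) (A ^ (k - j) * B ^ j))"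
    using g unfolding binary_form_def by blast
  \<comment> \<open>Multiplication by a monomial is multiplication by powers of the linear forms
    \<open>1 A + 0 B\<close> and \<open>0 A + 1 B\<close>.\<close>
  have "binary_form (n + k) (\<lambda>A B. smult (e j) (f A B * A ^ (k - j) * B ^ j))" if "j \<le> k" for j
    using binary_form_smult[OF binary_form_mult_linear_power[OF
        binary_form_mult_linear_power[OF f, of "k - j" 1 0], of j 0 1], of "e j"] that
    by simp
  hence "binary_form (n + k) (\<lambda>A B. \<Sum>j\<in>{..k}. smult (e j) (f A B * A ^ (k - j) * B ^ j))"
    by (intro binary_form_sum) auto
  thus ?thesis by (simp add: e sum_distrib_left mult_ac)
qed

text \<open>The recursion is isobaric: each product in it has degree
  \<open>i + (k - i) = k\<close>.\<close>

lemma binary_form_newton: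
  assumes "\<And>j. binary_form j (s j)"
  shows "binary_form k (\<lambda>A B. newton (\<lambda>j. s j A B) k)"
proof (induction k rule: less_induct)
  case (less k)
  show ?case
  proof (cases k)
    case 0
    thus ?thesis using binary_form_const[of 1] by (simp add: one_pCons)
  next
    case (Suc k')
    have "binary_form k (\<lambda>A B. newton (\<lambda>j. s j A B) i * s (k - i) A B)" if "i \<le> k'" for i
      using binary_form_mult[OF less[of i] assms[of "k - i"]] that Suc by simp
    hence "binary_form k (\<lambda>A B. \<Sum>i\<in>{..k'}. newton (\<lambda>j. s j A B) i * s (k - i) A B)"
      by (intro binary_form_sum) auto
    from binary_form_smult[OF this, of "- inverse (of_nat k)"] show ?thesis
      using Suc by simp
  qed
qed

lemma eval3_superset:
  assumes "finite K" "Poly_Mapping.keys g \<subseteq> K"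
  shows "eval3 g (u, v, w) =
    (\<Sum>(i, j, k)\<in>K. Poly_Mapping.lookup g (i, j, k) * u ^ i * v ^ j * w ^ k)"
  unfolding eval3.simps using assms by (intro sum.mono_neutral_left) (auto simp: in_keys_iff)

text \<open>Powers of the third variable fill the degrees up to \<open>n\<close>. The form
  \<open>a 0\<close> is a constant, the coefficient of \<open>W^n\<close>, so its being nonzero
  keeps \<open>g\<close> nonzero.\<close>

lemma ternary_form_of_binary_forms:
  fixes a :: "nat \<Rightarrow> 'a::field poly \<Rightarrow> 'a poly \<Rightarrow> 'a poly"
  assumes a: "\<And>k. k \<le> n \<Longrightarrow> binary_form k (a k)" and a0: "a 0 1 1 \<noteq> 0"
  obtains g :: "'a poly3" where "envelope n g"
    and "\<And>A B C. eval3 (Poly_Mapping.map (\<lambda>x. [:x:]) g) (A, B, C) = (\<Sum>k\<le>n. a k A B * C ^ (n - k))"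
proof -
  have "\<forall>k\<in>{..n}. \<exists>e. \<forall>A B. a k A B = (\<Sum>j\<le>k. smult (e j) (A ^ (k - j) * B ^ j))"
    using a unfolding binary_form_def by blast
  then obtain e where e: "\<And>k A B. k \<le> n \<Longrightarrow> a k A B = (\<Sum>j\<le>k. smult (e k j) (A ^ (k - j) * B ^ j))"
    by (metis atMost_iff)
  define I where "I = (SIGMA k:{..n}. {..k})"
  \<comment> \<open>The \<open>j\<close>-th term of \<open>a k\<close> contributes to the monomial
    \<open>U^(k - j) V^j W^(n - k)\<close>; conversely \<open>k\<close> is the sum of the first two
    exponents, as used in \<open>c\<close>.\<close>
  define \<phi> where "\<phi> = (\<lambda>(k, j). (k - j, j, n - k))"
  define K where "K = \<phi> ` I"
  define c where "c = (\<lambda>(i, j, r). if (i, j, r) \<in> K then e (i + j) j else 0)"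
  define g where "g = Abs_poly_mapping c"
  have fin: "finite I" "finite K" by (auto simp: I_def K_def)
  have "finite {x. c x \<noteq> 0}"
    by (rule finite_subset[OF _ fin(2)]) (auto simp: c_def split: if_splits)
  hence lk: "Poly_Mapping.lookup g = c" unfolding g_def by (rule lookup_Abs_poly_mapping)
  have keys: "Poly_Mapping.keys g \<subseteq> K"
    by (auto simp: in_keys_iff lk c_def split: if_splits)
  have "homogeneous3 n g"
    unfolding homogeneous3_def using keys by (auto simp: K_def I_def \<phi>_def)
  moreover have "g \<noteq> 0"
  proof
    assume "g = 0"
    hence "c (0, 0, n) = 0" by (simp flip: lk)
    moreover have "(0, 0, n) \<in> K" unfolding K_def I_def \<phi>_def by (auto intro!: image_eqI[of _ _ "(0, 0)"])
    ultimately show False using a0 e[of 0 1 1] by (simp add: c_def)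
  qed
  ultimately have "envelope n g" by (simp add: envelope_def)
  moreover have "eval3 (Poly_Mapping.map (\<lambda>x. [:x:]) g) (A, B, C) = (\<Sum>k\<le>n. a k A B * C ^ (n - k))"
    for A B C
  proof -
    have inj: "inj_on \<phi> I"
      by (auto simp: inj_on_def I_def \<phi>_def)
    have "eval3 (Poly_Mapping.map (\<lambda>x. [:x:]) g) (A, B, C) =
        (\<Sum>(i, j, r)\<in>K. [:c (i, j, r):] * A ^ i * B ^ j * C ^ r)"
      using eval3_superset[OF fin(2), of "Poly_Mapping.map (\<lambda>x. [:x:]) g"] keys
      by (simp only: keys_map_const lookup_map_const lk)
    also have "\<dots> = (\<Sum>(k, j)\<in>I. smult (e k j) (A ^ (k - j) * B ^ j) * C ^ (n - k))"
      unfolding K_def sum.reindex[OF inj]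
    proof (intro sum.cong refl)
      fix x assume x: "x \<in> I"
      hence "\<phi> x \<in> K" by (simp add: K_def)
      thus "((\<lambda>(i, j, r). [:c (i, j, r):] * A ^ i * B ^ j * C ^ r) \<circ> \<phi>) x =
         (case x of (k, j) \<Rightarrow> smult (e k j) (A ^ (k - j) * B ^ j) * C ^ (n - k))"
        using x by (auto simp: \<phi>_def c_def I_def)
    qed
    also have "\<dots> = (\<Sum>k\<le>n. a k A B * C ^ (n - k))"
      unfolding I_def by (subst sum.Sigma[symmetric]) (auto simp: e sum_distrib_right intro!: sum.cong)
    finally show ?thesis .
  qed
  ultimately show ?thesis using that by blast
qed

section \<open>Parallel classes in dual coordinates\<close>

lemma mem_affine_points: "(a, b) \<in> affine_points (u, v, w) \<longleftrightarrow> w = - (u * a + v * b)"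
  by (auto simp: affine_points_def eq_neg_iff_add_eq_0 algebra_simps)

lemma affine_points_nonempty:
  assumes "(u, v) \<noteq> (0, 0)"
  obtains a b where "(a, b) \<in> affine_points (u, v, w)"
proof (cases "u = 0")
  case True
  thus ?thesis using assms that[of 0 "- w / v"] by (auto simp: mem_affine_points)
next
  case False
  thus ?thesis using that[of "- w / u" 0] by (auto simp: mem_affine_points)
qed

lemma inj_affine_points:
  assumes "(u, v) \<noteq> (0, 0)"
  shows "inj (\<lambda>w. affine_points (u, v, w))"
proof (rule injI)
  fix w w' assume *: "affine_points (u, v, w) = affine_points (u, v, w')"
  obtain a b where "(a, b) \<in> affine_points (u, v, w)" using affine_points_nonempty[OF assms] .
  with * show "w = w'" by (metis mem_affine_points)
qed

lemma incident_direction_cong: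
  "incident (direction_point d) (u, v, w) \<longleftrightarrow> incident (direction_point d) (u, v, w')"
  by (cases d) auto

text \<open>Passing through the direction is one linear condition on the first two coordinates, so
  these are proportional for all lines of the class and can be rescaled to \<open>(u, v)\<close>.
  Thus \<open>w\<close> ranging over the field parametrises the class.\<close>

lemma affine_lines_eq_range:
  assumes uv: "(u, v) \<noteq> (0, 0)" and inc: "incident (direction_point d) (u, v, w)"
  shows "affine_lines d = range (\<lambda>w. affine_points (u, v, w))"
proof (intro equalityI subsetI)
  fix L assume "L \<in> range (\<lambda>w. affine_points (u, v, w))"
  then obtain w' where "L = affine_points (u, v, w')" by blast
  thus "L \<in> affine_lines d"
    using uv inc incident_direction_cong[of d u v w w']
    unfolding affine_lines_def affine_line_coords_def by blast
next
  fix L assume "L \<in> affine_lines d"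
  then obtain u' v' w' where l': "L = affine_points (u', v', w')" "(u', v') \<noteq> (0, 0)"
      "incident (direction_point d) (u', v', w')"
    unfolding affine_lines_def affine_line_coords_def by auto
  obtain r where r: "r \<noteq> 0" "u' = r * u" "v' = r * v"
  proof (cases d)
    case (Slope \<delta>)
    hence "u = - v * \<delta>" "u' = - v' * \<delta>" using inc l'(3) by (auto simp: eq_neg_iff_add_eq_0)
    thus ?thesis using that[of "v' / v"] uv l'(2) by auto
  next
    case Vertical
    hence "v = 0" "v' = 0" using inc l'(3) by auto
    thus ?thesis using that[of "u' / u"] uv l'(2) by auto
  qed
  have "L = affine_points (u, v, w' / r)"
    unfolding l'(1) using r by (auto simp: mem_affine_points field_simps)
  thus "L \<in> range (\<lambda>w. affine_points (u, v, w))" by blast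
qed

text \<open>Membership in \<open>affine_lines d\<close> only provides some coordinates of the point
  set. Invariance of that set under translation by the direction vector carries the incidence over
  to the given \<open>l\<close>.\<close>

lemma affine_line_incident:
  assumes "l \<in> affine_line_coords" "affine_points l \<in> affine_lines d"
  shows "incident (direction_point d) l"
proof -
  obtain u v w where l: "l = (u, v, w)" "(u, v) \<noteq> (0, 0)"
    using assms(1) by (auto simp: affine_line_coords_def)
  obtain u' v' w' where l': "affine_points l = affine_points (u', v', w')"
      "incident (direction_point d) (u', v', w')"
    using assms(2) unfolding affine_lines_def by auto
  obtain x y where xy: "direction_point d = (x, y, 0)" by (cases d) auto
  obtain a b where ab: "(a, b) \<in> affine_points (u, v, w)" using affine_points_nonempty[OF l(2)] .
  hence "(a, b) \<in> affine_points (u', v', w')" using l l' by simp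
  hence "(a + x, b + y) \<in> affine_points (u', v', w')"
    using l'(2) by (simp add: xy mem_affine_points algebra_simps)
  hence "(a + x, b + y) \<in> affine_points (u, v, w)" using l l' by simp
  hence "u * (a + x) + v * (b + y) = u * a + v * b" using ab by (metis mem_affine_points neg_equal_iff_equal)
  thus ?thesis by (simp add: xy l algebra_simps)
qed

lemma direction_line:
  obtains u v where "(u, v) \<noteq> (0, 0)" "incident (direction_point d) (u, v, 0)"
proof (cases d)
  case (Slope \<delta>)
  thus ?thesis using that[of "- \<delta>" 1] by auto
next
  case Vertical
  thus ?thesis using that[of 1 0] by auto
qed

lemma intersection_number_eq_sum:
  "intersection_number T L = (\<Sum>x\<in>set_mset T. if x \<in> L then count T x else 0)"
proof -
  have "intersection_number T L = (\<Sum>x\<in>set_mset {#P \<in># T. P \<in> L#}. count T x)"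
    unfolding intersection_number_def size_multiset_overloaded_eq by (intro sum.cong) auto
  also have "\<dots> = (\<Sum>x\<in>set_mset T. if x \<in> L then count T x else 0)"
    by (intro sum.mono_neutral_cong_left) auto
  finally show ?thesis .
qed

text \<open>Double counting: for fixed \<open>(u, v)\<close> every point of \<open>T\<close> lies on
  the line of exactly one \<open>w\<close>.\<close>

lemma sum_intersection_number_power:
  fixes T :: "('a::{field,finite} \<times> 'a) multiset"
  shows "(\<Sum>w\<in>UNIV. of_nat (intersection_number T (affine_points (u, v, w))) * w ^ j) =
    (\<Sum>x\<in>set_mset T. of_nat (count T x) * (- (u * fst x + v * snd x)) ^ j)"
proof -
  have "(\<Sum>w\<in>UNIV. of_nat (intersection_number T (affine_points (u, v, w))) * w ^ j) =
      (\<Sum>w\<in>UNIV. \<Sum>x\<in>set_mset T.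
        if w = - (u * fst x + v * snd x) then of_nat (count T x) * w ^ j else 0)"
    unfolding intersection_number_eq_sum of_nat_sum sum_distrib_right
    by (intro sum.cong refl) (auto simp: mem_affine_points)
  also have "\<dots> = (\<Sum>x\<in>set_mset T. \<Sum>w\<in>UNIV.
        if w = - (u * fst x + v * snd x) then of_nat (count T x) * w ^ j else 0)"
    by (rule sum.swap)
  finally show ?thesis by simp
qed

section \<open>Weights of the renitent lines\<close>

text \<open>The value 0 off the renitent lines lets sums run over a whole parallel class; there
  \<open>weight\<close> itself is a description that nothing satisfies.\<close>

definition line_weight ::
  "nat \<Rightarrow> ('a::field \<times> 'a) multiset \<Rightarrow> int \<Rightarrow> 'a direction \<Rightarrow> int \<Rightarrow> ('a \<times> 'a) set \<Rightarrow> nat" where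
  "line_weight p T c d m L =
     (if L \<in> renitent_lines p T d m then weight p c m (intersection_number T L) else 0)"

lemma weight_spec:
  assumes "prime p" "\<not> int p dvd c" "\<not> [int t = m] (mod int p)"
  shows "weight p c m t \<in> {1..p - 1}" "[c * int (weight p c m t) = int t - m] (mod int p)"
  using theI'[OF weight_ex1[OF assms]] unfolding weight_def by blast+

lemma total_weight_eq_sum:
  fixes T :: "('a::{field,finite} \<times> 'a) multiset"
  assumes uv: "(u, v) \<noteq> (0, 0)" and inc: "incident (direction_point d) (u, v, w0)"
  shows "total_weight p T c d m = (\<Sum>w\<in>UNIV. line_weight p T c d m (affine_points (u, v, w)))"
proof -
  have "(\<Sum>w\<in>UNIV. line_weight p T c d m (affine_points (u, v, w))) =
      (\<Sum>L\<in>affine_lines d. line_weight p T c d m L)"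
    unfolding affine_lines_eq_range[OF assms] by (simp add: sum.reindex[OF inj_affine_points[OF uv]])
  also have "\<dots> = (\<Sum>L\<in>renitent_lines p T d m. weight p c m (intersection_number T L))"
    by (intro sum.mono_neutral_cong_right) (auto simp: line_weight_def renitent_lines_def)
  finally show ?thesis by (simp add: total_weight_def)
qed

text \<open>In the field, \<open>c\<close> times the weight is the intersection number minus
  \<open>m\<close> on every line of the class, and the constant \<open>m\<close> is killed by the
  vanishing power sum.\<close>

lemma line_weight_power_sum:
  fixes T :: "('a::{field,finite} \<times> 'a) multiset"
  assumes p: "prime p" "CHAR('a) = p" and c: "\<not> int p dvd c"
    and uv: "(u, v) \<noteq> (0, 0)" and inc: "incident (direction_point d) (u, v, w0)"
    and j: "j \<le> CARD('a) - 2"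
  shows "of_int c * (\<Sum>w\<in>UNIV. of_nat (line_weight p T c d m (affine_points (u, v, w))) * w ^ j) =
    (\<Sum>x\<in>set_mset T. of_nat (count T x) * (- (u * fst x + v * snd x)) ^ j)"
proof -
  have eq: "of_int c * of_nat (line_weight p T c d m L) =
      of_nat (intersection_number T L) - (of_int m :: 'a)" if "L \<in> affine_lines d" for L
  proof -
    have "[c * int (line_weight p T c d m L) = int (intersection_number T L) - m] (mod int p)"
    proof (cases "[int (intersection_number T L) = m] (mod int p)")
      case True
      hence "line_weight p T c d m L = 0" by (simp add: line_weight_def renitent_lines_def)
      moreover have "[0 = int (intersection_number T L) - m] (mod int p)"
        using True by (simp only: cong_diff_iff_cong_0 cong_sym_eq[of 0])
      ultimately show ?thesis by (simp only: of_nat_0 mult_zero_right)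
    next
      case False
      thus ?thesis using weight_spec(2)[OF p(1) c False] that
        by (simp add: line_weight_def renitent_lines_def)
    qed
    hence "of_int (c * int (line_weight p T c d m L)) =
        (of_int (int (intersection_number T L) - m) :: 'a)"
      by (simp only: of_int_eq_iff_cong_CHAR p(2))
    thus ?thesis by simp
  qed
  have "of_int c * (\<Sum>w\<in>UNIV. of_nat (line_weight p T c d m (affine_points (u, v, w))) * w ^ j) =
      (\<Sum>w\<in>UNIV. (of_nat (intersection_number T (affine_points (u, v, w))) - of_int m) * w ^ j)"
    unfolding sum_distrib_left mult.assoc[symmetric]
    by (intro sum.cong refl arg_cong2[where f = "(*)"] eq)
       (auto simp: affine_lines_eq_range[OF uv inc])
  also have "\<dots> = (\<Sum>w\<in>UNIV. of_nat (intersection_number T (affine_points (u, v, w))) * w ^ j)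
      - of_int m * (\<Sum>w\<in>UNIV. w ^ j)"
    by (simp add: left_diff_distrib sum_subtractf sum_distrib_left)
  finally show ?thesis
    by (simp add: power_sum_UNIV_eq_0[OF j] sum_intersection_number_power)
qed

text \<open>This is the power sum for \<open>j = 0\<close>; its right-hand side no longer sees the
  direction.\<close>

lemma total_weight_cong:
  fixes T :: "('a::{field,finite} \<times> 'a) multiset"
  assumes p: "prime p" "CHAR('a) = p" and c: "\<not> int p dvd c"
  shows "of_int c * of_nat (total_weight p T c d m) = (of_nat (size T) :: 'a)"
proof -
  obtain u v where uv: "(u, v) \<noteq> (0, 0)" "incident (direction_point d) (u, v, 0)"
    by (rule direction_line)
  show ?thesis
    using line_weight_power_sum[OF assms uv, of 0 T m]
    by (simp add: total_weight_eq_sum[OF uv] size_multiset_overloaded_eq)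
qed

section \<open>The envelope\<close>

lemma poly_restrict3_0: "poly (restrict3 g l l') 0 = eval3 g l"
proof -
  obtain u v w u' v' w' where "l = (u, v, w)" "l' = (u', v', w')" by (cases l, cases l')
  thus ?thesis by (simp add: keys_map_const lookup_map_const poly_sum case_prod_unfold mult.assoc)
qed

text \<open>Only the factor with \<open>w = z\<close> vanishes at 0.\<close>

lemma order_prod_linear_power:
  fixes \<mu> :: "'a::{field,finite} \<Rightarrow> nat"
  shows "order 0 (\<Prod>w\<in>UNIV. [:z - w, 1:] ^ \<mu> w) = \<mu> z"
proof -
  let ?r = "\<Prod>w\<in>UNIV - {z}. [:z - w, 1:] ^ \<mu> w"
  have r: "poly ?r 0 \<noteq> 0" by (simp add: poly_prod)
  hence "?r \<noteq> 0" by force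
  moreover have "(\<Prod>w\<in>UNIV. [:z - w, 1:] ^ \<mu> w) = [:0, 1:] ^ \<mu> z * ?r"
    by (subst prod.remove[of UNIV z]) auto
  ultimately show ?thesis
    using order_power_n_n[of "0 :: 'a" "\<mu> z"] by (simp add: order_mult order_0I[OF r])
qed

lemma pcompose_linear_power:
  fixes z w :: "'a::comm_ring_1"
  shows "pcompose ([:- w, 1:] ^ k) [:z, 1:] = [:z - w, 1:] ^ k"
proof -
  have "pcompose [:- w, 1:] [:z, 1:] = [:z - w, 1:]" by (simp add: pcompose_pCons)
  thus ?thesis by (induction k) (simp_all only: power_0 power_Suc pcompose_1 pcompose_mult)
qed

lemma sum_coeff_power_eq_pcompose:
  fixes f :: "'a::field poly"
  assumes "degree f = n"
  shows "(\<Sum>k\<le>n. [:coeff f (n - k):] * q ^ (n - k)) = pcompose f q"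
proof -
  have "(\<Sum>k\<le>n. [:coeff f (n - k):] * q ^ (n - k)) = (\<Sum>i\<le>n. [:coeff f i:] * q ^ i)"
    by (rule sum.reindex_bij_witness[of _ "\<lambda>i. n - i" "\<lambda>i. n - i"]) auto
  thus ?thesis
    using assms by (simp add: pcompose_altdef poly_altdef coeff_map_poly degree_map_poly)
qed

theorem theorem2p4:
  fixes p h :: nat and lam c :: int
    and T :: "('a::{field,finite} \<times> 'a) multiset"
    and F :: "'a direction set"
    and m :: "'a direction \<Rightarrow> int"
  assumes "prime p" and "h > 0" and "CARD('a) = p ^ h"
    and "\<forall>d\<in>F. uniform_direction p T lam d"
    and "\<forall>d\<in>F. typical_intersection_number p T lam d (m d)"
    and "\<forall>d\<in>F. 0 < card (renitent_lines p T d (m d)) \<and> int (card (renitent_lines p T d (m d))) \<le> lam"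
    and "\<not> int p dvd c"
    and "\<forall>d\<in>F. total_weight p T c d (m d) \<le> min (CARD('a) - 2) (p - 1)"
  shows "\<exists>n. (\<forall>d\<in>F. total_weight p T c d (m d) = n) \<and>
           (\<exists>g :: 'a poly3. envelope n g \<and>
             (\<forall>d\<in>F. \<forall>l\<in>affine_line_coords. affine_points l \<in> renitent_lines p T d (m d) \<longrightarrow>
                line_in_envelope l g \<and>
                pencil_multiplicity (direction_point d) g l =
                  enat (weight p c (m d) (intersection_number T (affine_points l)))))"
proof -
  note p = assms(1) and c = assms(7)
  have "CHAR('a) dvd p ^ h" using CHAR_dvd_CARD[where 'a = 'a] assms(3) by simp
  moreover have "prime CHAR('a)"
    by (intro prime_CHAR_semidom finite_imp_CHAR_pos) simp
  ultimately have char: "CHAR('a) = p"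
    using p prime_dvd_power primes_dvd_imp_eq by blast
  have p0: "p > 0" using p by (simp add: prime_gt_0_nat)
  have c0: "(of_int c :: 'a) \<noteq> 0" using c by (simp add: of_int_eq_0_iff_char_dvd char)

  \<comment> \<open>Both totals are congruent modulo \<open>p\<close> and, by the bound
    \<open>p - 1\<close>, smaller than \<open>p\<close>.\<close>
  have "total_weight p T c d (m d) = total_weight p T c d' (m d')" if "d \<in> F" "d' \<in> F" for d d'
  proof -
    have "of_int c * of_nat (total_weight p T c d (m d)) =
        of_int c * (of_nat (total_weight p T c d' (m d')) :: 'a)"
      by (simp only: total_weight_cong[OF p char c])
    hence "[total_weight p T c d (m d) = total_weight p T c d' (m d')] (mod p)"
      using c0 by (simp add: of_nat_eq_iff_cong_CHAR char)
    moreover have "total_weight p T c d (m d) < p" "total_weight p T c d' (m d') < p"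
      using bspec[OF assms(8) that(1)] bspec[OF assms(8) that(2)] p0 by auto
    ultimately show ?thesis by (rule cong_less_modulus_unique_nat)
  qed
  \<comment> \<open>If \<open>F\<close> is empty, any \<open>n\<close> within the bound will
    do.\<close>
  then have "\<exists>n. (\<forall>d\<in>F. total_weight p T c d (m d) = n) \<and> n \<le> min (CARD('a) - 2) (p - 1)"
    using assms(8) by (cases "F = {}") (blast, metis ex_in_conv)
  then obtain n where n: "\<And>d. d \<in> F \<Longrightarrow> total_weight p T c d (m d) = n"
      and n_le: "n \<le> CARD('a) - 2" "n \<le> p - 1"
    by auto

  \<comment> \<open>The common value of the power sums, divided by \<open>c\<close> and with forms
    in place of \<open>u\<close> and \<open>v\<close>. Since \<open>d\<close> does not occur in it,
    a single \<open>g\<close> serves all directions.\<close>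
  define s :: "nat \<Rightarrow> 'a poly \<Rightarrow> 'a poly \<Rightarrow> 'a poly" where
    "s j A B = smult (inverse (of_int c)) (\<Sum>x\<in>set_mset T.
      smult (of_nat (count T x)) ((smult (- fst x) A + smult (- snd x) B) ^ j))" for j A B
  have summand: "binary_form j (\<lambda>A B. smult (of_nat (count T x)) ((smult (- fst x) A + smult (- snd x) B) ^ j))"
    for j x
    using binary_form_smult[OF binary_form_mult_linear_power[OF binary_form_const[of 1], of j "- fst x" "- snd x"]]
    by (simp add: one_pCons[symmetric])
  have s: "binary_form j (s j)" for j
    unfolding s_def by (rule binary_form_smult, rule binary_form_sum) (simp only: finite_set_mset, rule summand)
  obtain g :: "'a poly3" where env: "envelope n g"
    and g: "\<And>A B C. eval3 (Poly_Mapping.map (\<lambda>x. [:x:]) g) (A, B, C) =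
      (\<Sum>k\<le>n. newton (\<lambda>j. s j A B) k * C ^ (n - k))"
    by (rule ternary_form_of_binary_forms[where n = n and a = "\<lambda>k A B. newton (\<lambda>j. s j A B) k"])
       (rule binary_form_newton[OF s], simp, rule that)

  have "line_in_envelope l g \<and> pencil_multiplicity (direction_point d) g l =
      enat (weight p c (m d) (intersection_number T (affine_points l)))"
    if d: "d \<in> F" and l: "l \<in> affine_line_coords" and ren: "affine_points l \<in> renitent_lines p T d (m d)"
    for d l
  proof -
    obtain u v z where l': "l = (u, v, z)" and uv: "(u, v) \<noteq> (0, 0)"
      using l by (auto simp: affine_line_coords_def)
    have inc: "incident (direction_point d) (u, v, z)"
      using affine_line_incident[OF l] ren by (simp add: renitent_lines_def l')
    define \<mu> where "\<mu> w = line_weight p T c d (m d) (affine_points (u, v, w))" for w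
    define f where "f = (\<Prod>w\<in>UNIV. [:- w, 1:] ^ \<mu> w)"
    have \<mu>z: "\<mu> z = weight p c (m d) (intersection_number T (affine_points l))"
      using ren by (simp add: \<mu>_def line_weight_def l')
    hence \<mu>_pos: "\<mu> z \<noteq> 0"
      using weight_spec(1)[OF p c, of _ "m d"] ren by (force simp: renitent_lines_def)
    have sum_\<mu>: "(\<Sum>w\<in>UNIV. \<mu> w) = n"
      unfolding \<mu>_def total_weight_eq_sum[OF uv inc, symmetric] by (rule n[OF d])
    hence deg: "degree f = n" by (simp add: f_def degree_prod_linear_power)

    \<comment> \<open>Here \<open>n \<le> q - 2\<close> makes all power sums up to \<open>n\<close>
      available; next, \<open>n \<le> p - 1\<close> makes \<open>1, ..., n\<close>
      invertible.\<close>
    have "s j [:u:] [:v:] = [:\<Sum>w\<in>UNIV. of_nat (\<mu> w) * w ^ j:]" if "j \<le> n" for j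
    proof -
      have "s j [:u:] [:v:] = [:inverse (of_int c) * (\<Sum>x\<in>set_mset T.
          of_nat (count T x) * (- (u * fst x + v * snd x)) ^ j):]"
        by (simp add: s_def poly_const_pow mult.commute sum_to_poly)
      also have "\<dots> = [:inverse (of_int c) * (of_int c * (\<Sum>w\<in>UNIV. of_nat (\<mu> w) * w ^ j)):]"
        using line_weight_power_sum[OF p char c uv inc, of j T "m d"] that n_le by (simp add: \<mu>_def)
      finally show ?thesis using c0 by simp
    qed
    moreover have "of_nat k \<noteq> (0 :: 'a)" if "0 < k" "k \<le> n" for k
      using that n_le p0 by (auto simp: of_nat_eq_0_iff_char_dvd char dest: dvd_imp_le)
    ultimately have "newton (\<lambda>j. s j [:u:] [:v:]) k = [:coeff f (n - k):]" if "k \<le> n" for k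
      using newton_eq_coeff[of UNIV \<mu> "\<lambda>j. s j [:u:] [:v:]" k] that
      by (simp add: sum_\<mu> f_def)
    \<comment> \<open>The line at infinity \<open>(0, 0, 1)\<close> belongs to every pencil centered
      at a direction. With it as second line, the parameter \<open>X\<close> stands for
      \<open>[u : v : z + X]\<close>, so the restriction is \<open>f\<close> shifted by
      \<open>z\<close>.\<close>
    hence "restrict3 g l (0, 0, 1) = (\<Sum>k\<le>n. [:coeff f (n - k):] * [:z, 1:] ^ (n - k))"
      by (simp add: l' g del: eval3.simps)
    also have "\<dots> = pcompose f [:z, 1:]"
      by (rule sum_coeff_power_eq_pcompose[OF deg])
    also have "\<dots> = (\<Prod>w\<in>UNIV. [:z - w, 1:] ^ \<mu> w)"
      by (simp add: f_def pcompose_prod pcompose_linear_power)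
    finally have res: "restrict3 g l (0, 0, 1) = (\<Prod>w\<in>UNIV. [:z - w, 1:] ^ \<mu> w)" .
    have nz: "restrict3 g l (0, 0, 1) \<noteq> 0" unfolding res by simp
    have ord: "order 0 (restrict3 g l (0, 0, 1)) = \<mu> z" unfolding res by (rule order_prod_linear_power)
    have "poly (restrict3 g l (0, 0, 1)) 0 = 0" using ord \<mu>_pos order_root by metis
    hence "line_in_envelope l g" by (simp add: line_in_envelope_def poly_restrict3_0)
    moreover have "direction_point d \<noteq> 0" by (cases d) (auto simp: zero_prod_def)
    moreover have "l \<noteq> 0" using uv by (auto simp: l' zero_prod_def)
    moreover have "(0, 0, 1) \<in> other_pencil_lines (direction_point d) l"
      using uv by (cases d) (auto simp: other_pencil_lines_def l' zero_prod_def)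
    ultimately show ?thesis
      using pencil_multiplicity_eq[of "direction_point d" l n g "(0, 0, 1)"] inc env nz ord
      by (simp add: l' envelope_def \<mu>z)
  qed
  thus ?thesis using n env by blast
qed

end
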